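(* Let $(\mathcal{N},[\cdot,\dots,\cdot],B)$ be a quadratic $n$-ary Nambu-Lie algebra and let $\theta\in Cent_S(\mathcal{N})$ be invertible. Let $B_\theta:\mathcal{N}\times\mathcal{N}\to\mathbb{K}$ be the bilinear form $B_\theta(x,y)=B(\theta x,y)$, and for a fixed $l\in\{1,\dots,n\}$ let $$\{x_1,\dots,x_n\}_l=[\theta x_1,\dots,\theta x_l,x_{l+1},\dots,x_n].$$ Then $(\mathcal{N},\{\cdot,\dots,\cdot\}_l,(\theta,\dots,\theta),B_\theta)$ is a quadratic $n$-ary Hom-Nambu-Lie algebra.
   Context: $\mathbb{K}$ is an algebraically closed field of characteristic zero and $n\ge2$. An $n$-ary Hom-Nambu-Lie algebra $(\mathcal{N},[\cdot,\dots,\cdot],\tilde\alpha)$, $\tilde\alpha=(\alpha_1,\dots,\alpha_{n-1})$, is a $\mathbb{K}$-vector space with a skew-symmetric $n$-linear bracket and linear maps $\alpha_i:\mathcal{N}\to\mathcal{N}$ satisfying $$[\alpha_1(x_1),\dots,\alpha_{n-1}(x_{n-1}),[y_1,\dots,y_n]]=\sum_{i=1}^n[\alpha_1(y_1),\dots,\alpha_{i-1}(y_{i-1}),[x_1,\dots,x_{n-1},y_i],\alpha_i(y_{i+1}),\dots,\alpha_{n-1}(y_n)].$$ It is quadratic with respect to $B$, written $(\mathcal{N},[\cdot,\dots,\cdot],\tilde\alpha,B)$, if $B$ is a nondegenerate symmetric bilinear form with $B([x_1,\dots,x_{n-1},y],z)+B(y,[x_1,\dots,x_{n-1},z])=0$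 and $B(\alpha_i(y),z)=B(y,\alpha_i(z))$ for all elements and all $i$. When all $\alpha_i=id$ these are called (quadratic) $n$-ary Nambu-Lie algebras. $Cent(\mathcal{N})=\{\theta\in End(\mathcal{N}):\theta[x_1,\dots,x_n]=[\theta x_1,x_2,\dots,x_n]\ \forall x_i\in\mathcal{N}\}$ and $Cent_S(\mathcal{N})=\{\theta\in Cent(\mathcal{N}): B(\theta x,y)=B(x,\theta y)\ \forall x,y\in\mathcal{N}\}$. *)

theory Defs
  imports
    "HOL-Computational_Algebra.Polynomial"
    "HOL-Combinatorics.Permutations"
begin

text \<open>
  An n-ary bracket on a vector space is a function on lists, of which only the values on
  lists of length n matter.  The twisting maps are likewise a list of length n - 1.
\<close>

definition multilinear_bracket ::
    "('k::field \<Rightarrow> 'v::ab_group_add \<Rightarrow> 'v) \<Rightarrow> nat \<Rightarrow> ('v list \<Rightarrow> 'v) \<Rightarrow> bool" where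
  "multilinear_bracket scale n br \<longleftrightarrow>
     (\<forall>xs i. length xs = n \<longrightarrow> i < n \<longrightarrow>
        Vector_Spaces.linear scale scale (\<lambda>v. br (xs[i := v])))"

definition skew_symmetric_bracket ::
    "('k::field \<Rightarrow> 'v::ab_group_add \<Rightarrow> 'v) \<Rightarrow> nat \<Rightarrow> ('v list \<Rightarrow> 'v) \<Rightarrow> bool" where
  "skew_symmetric_bracket scale n br \<longleftrightarrow>
     (\<forall>xs \<sigma>. length xs = n \<longrightarrow> \<sigma> permutes {..<n} \<longrightarrow>
        br (permute_list \<sigma> xs) = scale (of_int (sign \<sigma>)) (br xs))"

definition apply_maps :: "('v \<Rightarrow> 'v) list \<Rightarrow> 'v list \<Rightarrow> 'v list" where
  "apply_maps \<alpha>s xs = map2 (\<lambda>\<alpha> x. \<alpha> x) \<alpha>s xs"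

text \<open>
  Positions are counted from 0 in the sum of the Hom-Nambu identity: the entry of ys at
  position j is paired with the map at position j if it stands before the inner bracket,
  and with the map at position j - 1 if it stands after it.
\<close>

locale hom_nambu_lie_algebra = vector_space scale
  for scale :: "'k::field \<Rightarrow> 'v::ab_group_add \<Rightarrow> 'v" +
  fixes n :: nat and br :: "'v list \<Rightarrow> 'v" and \<alpha>s :: "('v \<Rightarrow> 'v) list"
  assumes arity: "n \<ge> 2"
    and multilinear: "multilinear_bracket scale n br"
    and skew_symmetric: "skew_symmetric_bracket scale n br"
    and length_twist: "length \<alpha>s = n - 1"
    and linear_twist: "\<And>\<alpha>. \<alpha> \<in> set \<alpha>s \<Longrightarrow> Vector_Spaces.linear scale scale \<alpha>"
    and hom_nambu_identity:
      "\<And>xs ys. length xs = n - 1 \<Longrightarrow> length ys = n \<Longrightarrow>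
         br (apply_maps \<alpha>s xs @ [br ys]) =
         (\<Sum>i<n. br (apply_maps (take i \<alpha>s) (take i ys) @ [br (xs @ [ys ! i])] @
                     apply_maps (drop i \<alpha>s) (drop (Suc i) ys)))"

definition bilinear_form ::
    "('k::field \<Rightarrow> 'v::ab_group_add \<Rightarrow> 'v) \<Rightarrow> ('v \<Rightarrow> 'v \<Rightarrow> 'k) \<Rightarrow> bool" where
  "bilinear_form scale B \<longleftrightarrow>
     (\<forall>x. Vector_Spaces.linear scale (*) (\<lambda>y. B x y)) \<and>
     (\<forall>y. Vector_Spaces.linear scale (*) (\<lambda>x. B x y))"

text \<open>
  For a symmetric form, as used below, nondegeneracy in one argument is nondegeneracy in both.
\<close>

definition nondegenerate_form :: "('v::zero \<Rightarrow> 'v \<Rightarrow> 'k::zero) \<Rightarrow> bool" where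
  "nondegenerate_form B \<longleftrightarrow> (\<forall>x. (\<forall>y. B x y = 0) \<longrightarrow> x = 0)"

locale quadratic_hom_nambu_lie_algebra = hom_nambu_lie_algebra scale n br \<alpha>s
  for scale :: "'k::field \<Rightarrow> 'v::ab_group_add \<Rightarrow> 'v" and n br \<alpha>s +
  fixes B :: "'v \<Rightarrow> 'v \<Rightarrow> 'k"
  assumes bilinear: "bilinear_form scale B"
    and symmetric: "\<And>x y. B x y = B y x"
    and nondegenerate: "nondegenerate_form B"
    and invariant: "\<And>xs y z. length xs = n - 1 \<Longrightarrow>
          B (br (xs @ [y])) z + B y (br (xs @ [z])) = 0"
    and twist_symmetric: "\<And>\<alpha> y z. \<alpha> \<in> set \<alpha>s \<Longrightarrow> B (\<alpha> y) z = B y (\<alpha> z)"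

abbreviation quadratic_nambu_lie_algebra ::
    "('k::field \<Rightarrow> 'v::ab_group_add \<Rightarrow> 'v) \<Rightarrow> nat \<Rightarrow> ('v list \<Rightarrow> 'v) \<Rightarrow> ('v \<Rightarrow> 'v \<Rightarrow> 'k) \<Rightarrow> bool" where
  "quadratic_nambu_lie_algebra scale n br B \<equiv>
     quadratic_hom_nambu_lie_algebra scale n br (replicate (n - 1) id) B"

definition Cent ::
    "('k::field \<Rightarrow> 'v::ab_group_add \<Rightarrow> 'v) \<Rightarrow> nat \<Rightarrow> ('v list \<Rightarrow> 'v) \<Rightarrow> ('v \<Rightarrow> 'v) set" where
  "Cent scale n br =
     {\<theta>. Vector_Spaces.linear scale scale \<theta> \<and>
         (\<forall>x xs. length (x # xs) = n \<longrightarrow> \<theta> (br (x # xs)) = br (\<theta> x # xs))}"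

definition Cent_S ::
    "('k::field \<Rightarrow> 'v::ab_group_add \<Rightarrow> 'v) \<Rightarrow> nat \<Rightarrow> ('v list \<Rightarrow> 'v) \<Rightarrow> ('v \<Rightarrow> 'v \<Rightarrow> 'k) \<Rightarrow>
     ('v \<Rightarrow> 'v) set" where
  "Cent_S scale n br B = {\<theta> \<in> Cent scale n br. \<forall>x y. B (\<theta> x) y = B x (\<theta> y)}"

definition twisted_bracket :: "('v list \<Rightarrow> 'v) \<Rightarrow> ('v \<Rightarrow> 'v) \<Rightarrow> nat \<Rightarrow> 'v list \<Rightarrow> 'v" where
  "twisted_bracket br \<theta> l xs = br (map \<theta> (take l xs) @ drop l xs)"

definition twisted_form :: "('v \<Rightarrow> 'v \<Rightarrow> 'k) \<Rightarrow> ('v \<Rightarrow> 'v) \<Rightarrow> 'v \<Rightarrow> 'v \<Rightarrow> 'k" where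
  "twisted_form B \<theta> x y = B (\<theta> x) y"

end

theory Submission
  imports Defs
begin

text \<open>
  By skew-symmetry, an element of the centroid can be pulled out of every slot of the bracket, not
  only the first one. Hence the twisted bracket is the original bracket followed by the l-th power
  of \<open>\<theta>\<close>, and each side of the Hom-Nambu identity is the image of the corresponding side of the
  Nambu identity under the power of \<open>\<theta>\<close> with exponent \<open>l + (n - 1) + l\<close>. Invariance follows
  by moving powers of \<open>\<theta>\<close> across the form.
\<close>

lemma apply_maps_replicate:
  "length xs = k \<Longrightarrow> apply_maps (replicate k f) xs = map f xs"
  unfolding apply_maps_def by (induction xs arbitrary: k) auto

text \<open>Transports a write at slot i to the head, the only slot that the definition of
  \<open>Cent\<close> speaks about: \<open>transpose 0 i\<close> is an involution, so what is stored
  at i is read at 0.\<close>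

lemma permute_list_transpose_update:
  assumes "i < length xs"
  shows "permute_list (transpose 0 i) (xs[i := v]) = (permute_list (transpose 0 i) xs)[0 := v]"
  using assms
  by (intro nth_equalityI)
     (auto simp: permute_list_def nth_list_update transpose_def)

lemma linear_funpow:
  assumes "Vector_Spaces.linear scale scale f"
  shows "Vector_Spaces.linear scale scale (f ^^ m)"
proof (induction m)
  case 0
  interpret Vector_Spaces.linear scale scale f by (fact assms)
  show ?case using vs1.linear_id by (simp add: id_def)
next
  case (Suc m)
  then show ?case
    using Vector_Spaces.linear_compose[OF Suc.IH assms] by (simp add: o_def)
qed

lemma funpow_self_adjoint:
  assumes "\<And>x y. B (f x) y = B x (f y)"
  shows "B ((f ^^ m) x) y = B x ((f ^^ m) y)"
  by (induction m arbitrary: x y) (simp_all add: assms funpow_swap1)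

text \<open>The transposition of 0 and i turns slot i into the head, where membership in
  \<open>Cent\<close> applies. Its sign occurs on both sides and cancels; for i = 0 it is the
  identity, so no case split arises.\<close>

lemma Cent_nth:
  fixes scale :: "'k::field \<Rightarrow> 'v::ab_group_add \<Rightarrow> 'v"
  assumes skew: "skew_symmetric_bracket scale n br"
    and cent: "\<theta> \<in> Cent scale n br"
    and len: "length xs = n" and i: "i < n"
  shows "br (xs[i := \<theta> v]) = \<theta> (br (xs[i := v]))"
proof -
  interpret \<theta>: Vector_Spaces.linear scale scale \<theta>
    using cent by (simp add: Cent_def)
  define \<tau> where "\<tau> = transpose 0 i"
  \<comment> \<open>The sign as a scalar of the field: 1 or -1, hence nonzero and cancellable at the
    end.\<close>
  define c :: 'k where "c = of_int (sign \<tau>)"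
  have c: "c \<noteq> 0"
    by (simp add: c_def sign_def)
  have \<tau>: "\<tau> permutes {..<n}"
    unfolding \<tau>_def using i by (intro permutes_swap_id) auto
  \<comment> \<open>The entry w stays free because both \<open>\<theta> v\<close> and v are inserted
    below.\<close>
  have swap: "br ((permute_list \<tau> xs)[0 := w]) = scale c (br (xs[i := w]))" for w
  proof -
    have "br (permute_list \<tau> (xs[i := w])) = scale c (br (xs[i := w]))"
      using skew \<tau> len by (simp add: skew_symmetric_bracket_def c_def)
    then show ?thesis
      using permute_list_transpose_update[of i xs w] len i by (simp add: \<tau>_def)
  qed
  have "length (permute_list \<tau> xs) = n"
    using len by simp
  then obtain y ys where ys: "permute_list \<tau> xs = y # ys" "length (y # ys) = n"
    using i by (cases "permute_list \<tau> xs") auto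
  have "scale c (br (xs[i := \<theta> v])) = br (\<theta> v # ys)"
    using swap[of "\<theta> v"] ys by simp
  also have "\<dots> = \<theta> (br (v # ys))"
    using cent ys by (simp add: Cent_def)
  also have "\<dots> = scale c (\<theta> (br (xs[i := v])))"
    using swap[of v] ys by (simp add: \<theta>.scale)
  finally show ?thesis
    using c by simp
qed

lemma Cent_slot:
  fixes scale :: "'k::field \<Rightarrow> 'v::ab_group_add \<Rightarrow> 'v"
  assumes "skew_symmetric_bracket scale n br" "\<theta> \<in> Cent scale n br"
    and "length (xs @ v # zs) = n"
  shows "br (xs @ \<theta> v # zs) = \<theta> (br (xs @ v # zs))"
  using Cent_nth[OF assms, of "length xs" v] assms(3) by simp

text \<open>Powers are needed because an inner twisted bracket sits in a single slot as a
  \<open>\<theta> ^^ l\<close> image.\<close>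

lemma Cent_funpow_slot:
  fixes scale :: "'k::field \<Rightarrow> 'v::ab_group_add \<Rightarrow> 'v"
  assumes "skew_symmetric_bracket scale n br" "\<theta> \<in> Cent scale n br"
    and "length (xs @ v # zs) = n"
  shows "br (xs @ (\<theta> ^^ m) v # zs) = (\<theta> ^^ m) (br (xs @ v # zs))"
  using assms(3) by (induction m) (simp_all add: Cent_slot[OF assms(1,2)])

text \<open>One factor is pulled out per entry from the left. The freed entry joins the prefix, so
  the induction has to vary xs.\<close>

lemma Cent_map:
  fixes scale :: "'k::field \<Rightarrow> 'v::ab_group_add \<Rightarrow> 'v"
  assumes "skew_symmetric_bracket scale n br" "\<theta> \<in> Cent scale n br"
    and "length (xs @ ys @ zs) = n"
  shows "br (xs @ map \<theta> ys @ zs) = (\<theta> ^^ length ys) (br (xs @ ys @ zs))"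
  using assms(3)
proof (induction ys arbitrary: xs)
  case (Cons y ys)
  have "br (xs @ map \<theta> (y # ys) @ zs) = \<theta> (br ((xs @ [y]) @ map \<theta> ys @ zs))"
    using Cons.prems by (simp add: Cent_slot[OF assms(1,2)])
  also have "\<dots> = \<theta> ((\<theta> ^^ length ys) (br ((xs @ [y]) @ ys @ zs)))"
    using Cons.prems by (subst Cons.IH) simp_all
  finally show ?case by simp
qed simp

lemma twisted_bracket_eq:
  fixes scale :: "'k::field \<Rightarrow> 'v::ab_group_add \<Rightarrow> 'v"
  assumes "skew_symmetric_bracket scale n br" "\<theta> \<in> Cent scale n br"
    and "length xs = n" "l \<le> n"
  shows "twisted_bracket br \<theta> l xs = (\<theta> ^^ l) (br xs)"
  using Cent_map[OF assms(1,2), of "[]" "take l xs" "drop l xs"] assms(3,4)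
  by (simp add: twisted_bracket_def min_def)

lemma hom_nambu_lie_algebra_twisted_bracket:
  fixes scale :: "'k::field \<Rightarrow> 'v::ab_group_add \<Rightarrow> 'v"
  assumes nambu: "hom_nambu_lie_algebra scale n br (replicate (n - 1) id)"
    and cent: "\<theta> \<in> Cent scale n br"
    and l: "l \<le> n"
  shows "hom_nambu_lie_algebra scale n (twisted_bracket br \<theta> l) (replicate (n - 1) \<theta>)"
proof -
  interpret N: hom_nambu_lie_algebra scale n br "replicate (n - 1) id"
    by (fact nambu)
  have lin: "Vector_Spaces.linear scale scale \<theta>"
    using cent by (simp add: Cent_def)
  interpret \<theta>: Vector_Spaces.linear scale scale \<theta> by (fact lin)
  note linp = linear_funpow[OF lin]
  note slot = Cent_funpow_slot[OF N.skew_symmetric cent]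
  note map = Cent_map[OF N.skew_symmetric cent]
  note tb = twisted_bracket_eq[OF N.skew_symmetric cent _ l]
  note n = N.arity
  \<comment> \<open>Both sides of the identity collect this power: l from the outer bracket, n - 1
    from the twisting maps and l from the inner bracket.\<close>
  define T where "T = \<theta> ^^ (l + (n - 1) + l)"
  interpret T: Vector_Spaces.linear scale scale T
    unfolding T_def by (rule linp)
  have T: "(\<theta> ^^ l) ((\<theta> ^^ (n - 1)) ((\<theta> ^^ l) v)) = T v" for v
    by (simp add: T_def funpow_add)
  show ?thesis
  proof unfold_locales
    show "n \<ge> 2" by (fact n)
  next
    show "multilinear_bracket scale n (twisted_bracket br \<theta> l)"
      unfolding multilinear_bracket_def
    proof (intro allI impI)
      fix xs :: "'v list" and i
      assume "length xs = n" "i < n"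
      then have "Vector_Spaces.linear scale scale ((\<theta> ^^ l) \<circ> (\<lambda>v. br (xs[i := v])))"
        using N.multilinear
        by (intro Vector_Spaces.linear_compose[OF _ linp]) (simp add: multilinear_bracket_def)
      then show "Vector_Spaces.linear scale scale (\<lambda>v. twisted_bracket br \<theta> l (xs[i := v]))"
        using \<open>length xs = n\<close> by (simp add: tb o_def)
    qed
  next
    interpret L: Vector_Spaces.linear scale scale "\<theta> ^^ l"
      by (rule linp)
    show "skew_symmetric_bracket scale n (twisted_bracket br \<theta> l)"
      using N.skew_symmetric by (simp add: skew_symmetric_bracket_def tb L.scale)
  next
    fix xs ys :: "'v list"
    assume xs: "length xs = n - 1" and ys: "length ys = n"
    let ?\<alpha> = "replicate (n - 1) \<theta>"
    let ?t = "\<lambda>i. br (take i ys @ br (xs @ [ys ! i]) # drop (Suc i) ys)"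
    \<comment> \<open>With identity twists the maps disappear from both sides, leaving the plain
      Nambu identity.\<close>
    have nambu_id: "br (xs @ [br ys]) = (\<Sum>i<n. ?t i)"
      unfolding N.hom_nambu_identity[OF xs ys, unfolded apply_maps_replicate[OF xs] list.map_id]
      using ys by (intro sum.cong) (simp_all add: apply_maps_replicate min_def)
    have lhs: "twisted_bracket br \<theta> l (apply_maps ?\<alpha> xs @ [twisted_bracket br \<theta> l ys])
        = T (br (xs @ [br ys]))"
      using map[of "[]" xs "[(\<theta> ^^ l) (br ys)]"] slot[of xs "br ys" "[]" l] xs ys n
      by (simp add: apply_maps_replicate tb T[unfolded One_nat_def])
    \<comment> \<open>Before the inner bracket stand i twisted entries and after it n - Suc i.
      Together they give n - 1 factors whatever i is, so the same T comes out of every summand, and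
      linearity takes it out of the sum.\<close>
    have rhs: "twisted_bracket br \<theta> l
        (apply_maps (take i ?\<alpha>) (take i ys) @ [twisted_bracket br \<theta> l (xs @ [ys ! i])] @
         apply_maps (drop i ?\<alpha>) (drop (Suc i) ys)) = T (?t i)" (is "?L = _") if i: "i < n" for i
    proof -
      let ?a = "take i ys" and ?b = "br (xs @ [ys ! i])" and ?c = "drop (Suc i) ys"
      have "?L = (\<theta> ^^ l) (br (map \<theta> ?a @ (\<theta> ^^ l) ?b # map \<theta> ?c))"
        using xs ys i by (simp add: apply_maps_replicate tb min_def)
      also have "br (map \<theta> ?a @ (\<theta> ^^ l) ?b # map \<theta> ?c)
          = (\<theta> ^^ i) (br (?a @ (\<theta> ^^ l) ?b # map \<theta> ?c))"
        using map[of "[]" ?a "(\<theta> ^^ l) ?b # map \<theta> ?c"] ys i by (simp add: min_def)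
      also have "br (?a @ (\<theta> ^^ l) ?b # map \<theta> ?c)
          = (\<theta> ^^ (n - Suc i)) (br (?a @ (\<theta> ^^ l) ?b # ?c))"
        using map[of "?a @ [(\<theta> ^^ l) ?b]" ?c "[]"] ys i by (simp add: min_def)
      also have "br (?a @ (\<theta> ^^ l) ?b # ?c) = (\<theta> ^^ l) (?t i)"
        using slot[of ?a ?b ?c l] ys i by (simp add: min_def)
      also have "(\<theta> ^^ i) ((\<theta> ^^ (n - Suc i)) ((\<theta> ^^ l) (?t i)))
          = (\<theta> ^^ (n - 1)) ((\<theta> ^^ l) (?t i))"
        using funpow_add[of i "n - Suc i" \<theta>] i by simp
      finally show ?thesis by (simp only: T)
    qed
    show "twisted_bracket br \<theta> l (apply_maps ?\<alpha> xs @ [twisted_bracket br \<theta> l ys]) =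
      (\<Sum>i<n. twisted_bracket br \<theta> l
        (apply_maps (take i ?\<alpha>) (take i ys) @ [twisted_bracket br \<theta> l (xs @ [ys ! i])] @
         apply_maps (drop i ?\<alpha>) (drop (Suc i) ys)))"
      unfolding lhs nambu_id T.sum by (intro sum.cong refl) (simp only: rhs lessThan_iff)
  \<comment> \<open>What remains concerns the list of twisting maps: its length and the linearity of
    its entries, all equal to \<open>\<theta>\<close>.\<close>
  qed (auto simp: \<theta>.add \<theta>.scale)
qed

theorem theorem6p12:
  fixes scale :: "'k::{alg_closed_field, field_char_0} \<Rightarrow> 'v::ab_group_add \<Rightarrow> 'v"
    and n l :: nat
    and br :: "'v list \<Rightarrow> 'v"
    and B :: "'v \<Rightarrow> 'v \<Rightarrow> 'k"
    and \<theta> :: "'v \<Rightarrow> 'v"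
  assumes "n \<ge> 2"
    and "quadratic_nambu_lie_algebra scale n br B"
    and "\<theta> \<in> Cent_S scale n br B"
    and "bij \<theta>"
    and "l \<in> {1..n}"
  shows "quadratic_hom_nambu_lie_algebra scale n (twisted_bracket br \<theta> l)
           (replicate (n - 1) \<theta>) (twisted_form B \<theta>)"
proof -
  interpret Q: quadratic_hom_nambu_lie_algebra scale n br "replicate (n - 1) id" B
    by (fact assms(2))
  have cent: "\<theta> \<in> Cent scale n br" and adj: "\<And>x y. B (\<theta> x) y = B x (\<theta> y)"
    using assms(3) by (auto simp: Cent_S_def)
  have lin: "Vector_Spaces.linear scale scale \<theta>"
    using cent by (simp add: Cent_def)
  have l: "l \<le> n"
    using assms(5) by simp
  \<comment> \<open>With the algebra structure in place, only the axioms about the form are left to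
    prove.\<close>
  interpret H: hom_nambu_lie_algebra scale n "twisted_bracket br \<theta> l" "replicate (n - 1) \<theta>"
    by (rule hom_nambu_lie_algebra_twisted_bracket[OF Q.hom_nambu_lie_algebra_axioms cent l])
  note tb = twisted_bracket_eq[OF Q.skew_symmetric cent _ l]
  interpret \<theta>: Vector_Spaces.linear scale scale \<theta> by (fact lin)
  show ?thesis
  proof unfold_locales
    have "Vector_Spaces.linear scale (*) ((\<lambda>x. B x y) \<circ> \<theta>)" for y
      using Q.bilinear by (intro Vector_Spaces.linear_compose[OF lin]) (simp add: bilinear_form_def)
    then show "bilinear_form scale (twisted_form B \<theta>)"
      using Q.bilinear by (simp add: bilinear_form_def twisted_form_def o_def)
  next
    show "twisted_form B \<theta> x y = twisted_form B \<theta> y x" for x y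
      by (simp add: twisted_form_def adj Q.symmetric[of x])
  next
    show "nondegenerate_form (twisted_form B \<theta>)"
      unfolding nondegenerate_form_def twisted_form_def
    proof (intro allI impI)
      fix x
      assume "\<forall>y. B (\<theta> x) y = 0"
      \<comment> \<open>Zero is written as \<open>\<theta> 0\<close> so that injectivity yields x =
        0.\<close>
      then have "\<theta> x = \<theta> 0"
        using Q.nondegenerate by (simp add: nondegenerate_form_def)
      then show "x = 0"
        using assms(4) by (blast dest: bij_is_inj injD)
    qed
  next
    fix xs :: "'v list" and y z
    assume xs: "length xs = n - 1"
    \<comment> \<open>All Suc l factors, l from the bracket and one from the form, are gathered on
      z. Here they cross the form together; in the second term the factor on y crosses first, and
      then all enter the last slot of the bracket. Invariance of B at y and
      \<open>(\<theta> ^^ Suc l) z\<close> concludes.\<close>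
    have "B (\<theta> ((\<theta> ^^ l) (br (xs @ [y])))) z = B (br (xs @ [y])) ((\<theta> ^^ Suc l) z)"
      using funpow_self_adjoint[of B \<theta> "Suc l", OF adj] by simp
    moreover have "B (\<theta> y) ((\<theta> ^^ l) (br (xs @ [z]))) = B y (br (xs @ [(\<theta> ^^ Suc l) z]))"
      using Cent_funpow_slot[OF Q.skew_symmetric cent, of xs z "[]" "Suc l"] xs Q.arity
      by (simp add: adj)
    ultimately show "twisted_form B \<theta> (twisted_bracket br \<theta> l (xs @ [y])) z +
        twisted_form B \<theta> y (twisted_bracket br \<theta> l (xs @ [z])) = 0"
      using Q.invariant[OF xs, of y "(\<theta> ^^ Suc l) z"] xs Q.arity
      by (simp add: twisted_form_def tb)
  next
    show "twisted_form B \<theta> (\<alpha> y) z = twisted_form B \<theta> y (\<alpha> z)"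
      if "\<alpha> \<in> set (replicate (n - 1) \<theta>)" for \<alpha> y z
      using that by (simp add: twisted_form_def adj split: if_splits)
  qed
qed

end
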